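(* Let $h$ be a left-invariant metric on $\mathrm{SO}(4)$ of nonnegative sectional curvature whose matrix $\Phi$ has a singular eigenvector. Then either (i) $\Phi(\mathfrak g_1)\subset\mathfrak g_1$ and $\Phi(\mathfrak g_2)\subset\mathfrak g_2$ ($h$ is a product metric), or (ii) there exist $h_0$-orthonormal bases $\{A_1,A_2,A_3\}$ of $\mathfrak g_1$ and $\{B_1,B_2,B_3\}$ of $\mathfrak g_2$ and real numbers $c,d,a_1,a_2,a_3$ such that $\Phi A_1=cA_1$, $\Phi A_2=cA_2$, $\Phi B_2=dB_2$, $\Phi B_3=dB_3$, $\Phi A_3=a_1A_3+a_3B_1$, $\Phi B_1=a_3A_3+a_2B_1$, and moreover $a_1\alpha^2+2a_3\alpha\beta+a_2\beta^2\le\tfrac43(c\alpha^2+d\beta^2)$ for all $\alpha,\beta\in\mathbb R$ (i.e. $h$ arises from a torus action as a known example of nonnegative curvature).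
   Context: $\mathfrak g=\mathfrak{so}(4)=\mathfrak g_1\oplus\mathfrak g_2$ with each $\mathfrak g_i\cong\mathfrak{so}(3)$; each factor carries the bi-invariant metric $\langle Z_1,Z_2\rangle=\tfrac12\operatorname{trace}(Z_1Z_2^T)$ and $h_0$ is the resulting bi-invariant product metric on $\mathfrak g$. The matrix of a left-invariant metric $h$ is the $h_0$-self-adjoint positive definite $\Phi$ with $h(X,Y)=h_0(\Phi X,Y)$. A vector of $\mathfrak g$ is singular if it lies in $\mathfrak g_1$ or in $\mathfrak g_2$. *)

theory Defs
  imports "HOL-Analysis.Analysis" "HOL-Analysis.Cross3"
begin

text \<open>Model of so(4) = g1 (+) g2 with g1, g2 isomorphic to so(3).
  so(3) is identified with real^3 via the hat map u |-> hat u (hat u v = u x v);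
  this is a Lie algebra isomorphism (hat (u x v) = [hat u, hat v]) and
  (1/2) trace (hat u * (hat v)^T) = u . v, so the bi-invariant metric h0 becomes
  the standard inner product of real^3 x real^3 (the product inner product).\<close>

type_synonym so4 = "(real^3) \<times> (real^3)"

definition lie :: "so4 \<Rightarrow> so4 \<Rightarrow> so4" where
  "lie X Y = (cross3 (fst X) (fst Y), cross3 (snd X) (snd Y))"

definition h0 :: "so4 \<Rightarrow> so4 \<Rightarrow> real" where
  "h0 X Y = X \<bullet> Y"

definition g1 :: "so4 set" where "g1 = {X. snd X = 0}"
definition g2 :: "so4 set" where "g2 = {X. fst X = 0}"

definition metric_matrix :: "(so4 \<Rightarrow> so4) \<Rightarrow> bool" where
  "metric_matrix \<Phi> \<longleftrightarrow> linear \<Phi> \<and> (\<forall>X Y. h0 (\<Phi> X) Y = h0 X (\<Phi> Y))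
      \<and> (\<forall>X. X \<noteq> 0 \<longrightarrow> h0 (\<Phi> X) X > 0)"

definition metric :: "(so4 \<Rightarrow> so4) \<Rightarrow> so4 \<Rightarrow> so4 \<Rightarrow> real" where
  "metric \<Phi> X Y = h0 (\<Phi> X) Y"

text \<open>Levi-Civita connection on left-invariant vector fields, via the Koszul formula.\<close>
definition nabla :: "(so4 \<Rightarrow> so4) \<Rightarrow> so4 \<Rightarrow> so4 \<Rightarrow> so4" where
  "nabla \<Phi> X Y = (THE W. \<forall>Z. metric \<Phi> W Z =
      (metric \<Phi> (lie X Y) Z - metric \<Phi> (lie Y Z) X + metric \<Phi> (lie Z X) Y) / 2)"

definition curv :: "(so4 \<Rightarrow> so4) \<Rightarrow> so4 \<Rightarrow> so4 \<Rightarrow> so4 \<Rightarrow> so4" where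
  "curv \<Phi> X Y Z = nabla \<Phi> X (nabla \<Phi> Y Z) - nabla \<Phi> Y (nabla \<Phi> X Z)
                   - nabla \<Phi> (lie X Y) Z"

text \<open>Nonnegative sectional curvature: h(R(X,Y)Y,X) >= 0 for all X, Y
  (sectional curvature of the plane spanned by independent X, Y is this divided
   by the positive quantity h(X,X)h(Y,Y)-h(X,Y)^2).\<close>
definition nonneg_sec_curv :: "(so4 \<Rightarrow> so4) \<Rightarrow> bool" where
  "nonneg_sec_curv \<Phi> \<longleftrightarrow> (\<forall>X Y. metric \<Phi> (curv \<Phi> X Y Y) X \<ge> 0)"

definition singular :: "so4 \<Rightarrow> bool" where
  "singular X \<longleftrightarrow> X \<in> g1 \<or> X \<in> g2"

definition orthonormal_basis3 :: "real^3 \<Rightarrow> real^3 \<Rightarrow> real^3 \<Rightarrow> bool" where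
  "orthonormal_basis3 u v w \<longleftrightarrow> u \<bullet> u = 1 \<and> v \<bullet> v = 1 \<and> w \<bullet> w = 1 \<and>
     u \<bullet> v = 0 \<and> u \<bullet> w = 0 \<and> v \<bullet> w = 0 \<and> span {u, v, w} = UNIV"

end

(* Let M be the inverse of Phi. Writing -<Phi e, e> <= <M f, f> - 2 <f, e> in Puettmann's formula
   for the plane spanned by M u and M v, with f the sum of [u, M v] and [M u, v], bounds the
   curvature above by an expression that is a cubic polynomial in M. For u in g1 and v in g2 this
   cubic does not change when multiples of the identity are added to the diagonal blocks of M.
   If M has an eigenvector in g1, a singular value decomposition of the off-diagonal block and
   nonnegativity of the cubic on a few explicit planes show that this block has rank at most one
   and, when it is nonzero, that M is diagonal off the plane coupled by it. The bound with
   constant 4/3 is the curvature of planes whose bracket lies in the coupled plane. *)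

theory Submission
  imports Defs
begin

subsection \<open>Puettmann's curvature formula\<close>

lemma lie_simps:
  "lie (X + X') Y = lie X Y + lie X' Y" "lie X (Y + Y') = lie X Y + lie X Y'"
  "lie (X - X') Y = lie X Y - lie X' Y" "lie X (Y - Y') = lie X Y - lie X Y'"
  "lie (r *\<^sub>R X) Y = r *\<^sub>R lie X Y" "lie X (r *\<^sub>R Y) = r *\<^sub>R lie X Y"
  "lie (- X) Y = - lie X Y" "lie X (- Y) = - lie X Y"
  "lie 0 Y = 0" "lie X 0 = 0" "lie X X = 0"
  by (simp_all add: lie_def prod_eq_iff cross3_simps left_diff_distrib)

lemma lie_skew: "lie Y X = - lie X Y"
  by (simp add: lie_def prod_eq_iff cross_skew[of "fst Y"] cross_skew[of "snd Y"])

text \<open>Ad-invariance of \<open>h0\<close>: in each factor this is the cyclic symmetry of the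
  scalar triple product.\<close>

lemma inner_lie: "lie X Y \<bullet> Z = X \<bullet> lie Y Z"
  by (simp add: lie_def inner_prod_def cross3_def inner_vec_def sum_3 algebra_simps)

section \<open>Connection and curvature in terms of the metric matrix and its inverse\<close>

locale metric_inverse =
  fixes \<Phi> M :: "so4 \<Rightarrow> so4"
  assumes mm: "metric_matrix \<Phi>"
    and lin: "linear M"
    and left: "\<And>X. M (\<Phi> X) = X"
    and right: "\<And>X. \<Phi> (M X) = X"
begin

lemma linear_Phi: "linear \<Phi>" using mm by (simp add: metric_matrix_def)

lemma selfadj: "\<Phi> X \<bullet> Y = X \<bullet> \<Phi> Y" using mm by (auto simp only: metric_matrix_def h0_def)

lemma M_selfadj: "M X \<bullet> Y = X \<bullet> M Y"
  using selfadj[of "M X" "M Y"] by (simp add: right)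

lemma Phi_nonneg: "\<Phi> X \<bullet> X \<ge> 0"
  using mm by (cases "X = 0") (auto simp: metric_matrix_def h0_def
    simp del: split_paired_All intro: less_imp_le)

lemmas PhiS = linear_add[OF linear_Phi] linear_diff[OF linear_Phi] linear_scale[OF linear_Phi]
  linear_neg[OF linear_Phi] linear_0[OF linear_Phi]
lemmas MS = linear_add[OF lin] linear_diff[OF lin] linear_scale[OF lin]
  linear_neg[OF lin] linear_0[OF lin]

lemma metric_eqI:
  assumes "\<And>Z. metric \<Phi> V Z = metric \<Phi> W Z"
  shows "V = W"
proof -
  have "(\<Phi> V - \<Phi> W) \<bullet> Z = 0" for Z
    using assms[of Z] by (simp add: metric_def h0_def inner_diff_left)
  then have "\<Phi> V = \<Phi> W" by (metis inner_eq_zero_iff right_minus_eq)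
  then show ?thesis by (metis left)
qed

text \<open>Ad-invariance isolates \<open>Z\<close> in every term of the Koszul formula, and
  applying \<open>M\<close> then strips off \<Phi>. Nondegeneracy of the metric supplies the
  uniqueness that the definite description asks for.\<close>

lemma nabla_eq:
  "nabla \<Phi> X Y = (1/2) *\<^sub>R (lie X Y + M (lie X (\<Phi> Y) - lie (\<Phi> X) Y))" (is "_ = ?W")
proof -
  have koszul: "metric \<Phi> ?W Z =
      (metric \<Phi> (lie X Y) Z - metric \<Phi> (lie Y Z) X + metric \<Phi> (lie Z X) Y) / 2" for Z
  proof -
    have "metric \<Phi> (lie Y Z) X = lie (\<Phi> X) Y \<bullet> Z"
      using inner_lie[of "\<Phi> X" Y Z] by (simp add: metric_def h0_def selfadj inner_commute)
    moreover have "metric \<Phi> (lie Z X) Y = lie X (\<Phi> Y) \<bullet> Z"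
      using inner_lie[of Z X "\<Phi> Y"] by (simp add: metric_def h0_def selfadj inner_commute)
    ultimately show ?thesis
      by (simp add: metric_def h0_def PhiS right inner_diff_left inner_add_left)
  qed
  show ?thesis unfolding nabla_def
  proof (rule the_equality)
    show "\<forall>Z. metric \<Phi> ?W Z =
      (metric \<Phi> (lie X Y) Z - metric \<Phi> (lie Y Z) X + metric \<Phi> (lie Z X) Y) / 2"
      using koszul by (intro allI)
  next
    fix W assume W: "\<forall>Z. metric \<Phi> W Z =
      (metric \<Phi> (lie X Y) Z - metric \<Phi> (lie Y Z) X + metric \<Phi> (lie Z X) Y) / 2"
    show "W = ?W"
      by (rule metric_eqI) (simp only: koszul W[THEN spec])
  qed
qed

lemma metric_nabla_eq:
  "metric \<Phi> (nabla \<Phi> X Y) Z =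
    (lie X Y \<bullet> \<Phi> Z + lie X (\<Phi> Y) \<bullet> Z - lie (\<Phi> X) Y \<bullet> Z) / 2"
  by (simp add: metric_def h0_def nabla_eq PhiS right inner_diff_left inner_add_left selfadj)

lemma inner_lie_swap: "lie X Y \<bullet> Z = - (lie X Z \<bullet> Y)"
proof -
  have "lie X Z \<bullet> Y = X \<bullet> lie Z Y" by (rule inner_lie)
  also have "\<dots> = - (lie X Y \<bullet> Z)" by (simp add: inner_lie lie_skew[of Z])
  finally show ?thesis by simp
qed

lemma metric_commute: "metric \<Phi> X Y = metric \<Phi> Y X"
  unfolding metric_def h0_def by (metis inner_commute selfadj)

text \<open>Compatibility of the connection with the metric: left-invariant fields have constant
  inner products, so covariant differentiation along \<open>X\<close> is skew.\<close>

lemma metric_nabla: "metric \<Phi> (nabla \<Phi> X U) V = - metric \<Phi> U (nabla \<Phi> X V)"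
  unfolding metric_commute[of U] metric_nabla_eq
  using inner_lie_swap[of X U "\<Phi> V"] inner_lie_swap[of X "\<Phi> U" V] inner_lie_swap[of "\<Phi> X" U V]
  by (simp add: field_simps)

text \<open>Puettmann's formula. Skewness of the connection moves the outer derivatives onto the
  last argument \<open>X\<close>, so that only products of first derivatives remain, and these are
  explicit.\<close>

lemma metric_curv:
  "metric \<Phi> (curv \<Phi> X Y Y) X =
     (lie (\<Phi> X) Y + lie X (\<Phi> Y)) \<bullet> lie X Y / 2 - 3/4 * (\<Phi> (lie X Y) \<bullet> lie X Y)
     + (lie X (\<Phi> Y) - lie (\<Phi> X) Y) \<bullet> M (lie X (\<Phi> Y) - lie (\<Phi> X) Y) / 4
     - M (lie X (\<Phi> X)) \<bullet> lie Y (\<Phi> Y)"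
proof -
  define E where "E = lie X Y"
  define B where "B = lie X (\<Phi> Y) - lie (\<Phi> X) Y"
  have nXY: "nabla \<Phi> X Y = (1/2) *\<^sub>R (E + M B)" by (simp add: nabla_eq E_def B_def)
  \<comment> \<open>Under exchange of \<open>X\<close> and \<open>Y\<close> the vector
    \<open>B\<close> is symmetric and \<open>E\<close> antisymmetric, so the product of the two
    mixed derivatives below is a difference of squares.\<close>
  have "lie Y (\<Phi> X) - lie (\<Phi> Y) X = B"
    unfolding B_def using lie_skew[of Y "\<Phi> X"] lie_skew[of "\<Phi> Y" X] by simp
  then have nYX: "nabla \<Phi> Y X = (1/2) *\<^sub>R (- E + M B)"
    by (simp add: nabla_eq E_def lie_skew[of Y X])
  have nXX: "nabla \<Phi> W W = M (lie W (\<Phi> W))" for W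
    by (simp add: nabla_eq lie_simps lie_skew[of "\<Phi> W" W] MS)
  have "metric \<Phi> (curv \<Phi> X Y Y) X = metric \<Phi> (nabla \<Phi> X (nabla \<Phi> Y Y)) X
      - metric \<Phi> (nabla \<Phi> Y (nabla \<Phi> X Y)) X - metric \<Phi> (nabla \<Phi> E Y) X"
    by (simp add: curv_def metric_def h0_def PhiS inner_diff_left E_def)
  also have "\<dots> = - metric \<Phi> (nabla \<Phi> Y Y) (nabla \<Phi> X X)
      + metric \<Phi> (nabla \<Phi> X Y) (nabla \<Phi> Y X) - metric \<Phi> (nabla \<Phi> E Y) X"
    using metric_nabla[of X "nabla \<Phi> Y Y" X] metric_nabla[of Y "nabla \<Phi> X Y" X] by linarith
  also have "metric \<Phi> (nabla \<Phi> Y Y) (nabla \<Phi> X X) = M (lie X (\<Phi> X)) \<bullet> lie Y (\<Phi> Y)"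
    by (simp add: nXX metric_def h0_def right inner_commute)
  also have "metric \<Phi> (nabla \<Phi> X Y) (nabla \<Phi> Y X) = (B \<bullet> M B - \<Phi> E \<bullet> E) / 4"
  proof -
    have "\<Phi> E \<bullet> M B = E \<bullet> B" by (simp add: selfadj right)
    then show ?thesis
      by (simp add: nXY nYX metric_def h0_def PhiS right inner_diff_left inner_add_left
          inner_diff_right inner_add_right inner_commute[of B E])
         (simp add: field_simps)
  qed
  also have "metric \<Phi> (nabla \<Phi> E Y) X =
      - ((lie (\<Phi> X) Y + lie X (\<Phi> Y)) \<bullet> E) / 2 + \<Phi> E \<bullet> E / 2"
  proof -
    have 1: "lie E Z \<bullet> X = - (lie X Z \<bullet> E)" for Z
      using inner_lie_swap[of Z E X] by (simp add: lie_skew[of _ Z])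
    have 2: "lie E Y \<bullet> \<Phi> X = - (lie (\<Phi> X) Y \<bullet> E)"
      using inner_lie_swap[of Y E "\<Phi> X"] by (simp add: lie_skew[of _ Y])
    have 3: "lie (\<Phi> E) Y \<bullet> X = - (\<Phi> E \<bullet> E)"
      unfolding inner_lie E_def lie_skew[of Y X] by simp
    show ?thesis
      unfolding metric_nabla_eq 1 2 3 inner_add_left by simp
  qed
  finally show ?thesis
    unfolding E_def[symmetric] B_def[symmetric] by (simp add: diff_divide_distrib)
qed

end

subsection \<open>A cubic bound for the curvature\<close>

text \<open>For X = \<open>M u\<close> and Y = \<open>M v\<close> one has g = [\<Phi> X, Y] and k =
  [X, \<Phi> Y]. With e = [X, Y] and f = e - M (g + k), this expression exceeds the curvature term
  of X and Y by 3/4 of <\<Phi> f, f>.\<close>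

definition cubic_curv :: "(so4 \<Rightarrow> so4) \<Rightarrow> so4 \<Rightarrow> so4 \<Rightarrow> real" where
  "cubic_curv M u v = (let g = lie u (M v); k = lie (M u) v in
     M g \<bullet> g + M k \<bullet> k + M g \<bullet> k - (g + k) \<bullet> lie (M u) (M v)
     - M (lie (M u) u) \<bullet> lie (M v) v)"

text \<open>Completing the square in the term of Puettmann's formula that involves \<Phi>.\<close>
lemma (in metric_inverse) cubic_curv_nonneg:
  assumes "nonneg_sec_curv \<Phi>"
  shows "cubic_curv M u v \<ge> 0"
proof -
  define g k e where "g = lie u (M v)" and "k = lie (M u) v" and "e = lie (M u) (M v)"
  have "0 \<le> metric \<Phi> (curv \<Phi> (M u) (M v) (M v)) (M u)"
    using assms by (simp only: nonneg_sec_curv_def)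
  also have "\<dots> = (g + k) \<bullet> e / 2 - 3/4 * (\<Phi> e \<bullet> e) + (k - g) \<bullet> M (k - g) / 4
      - M (lie (M u) u) \<bullet> lie (M v) v"
    by (simp add: metric_curv right g_def k_def e_def)
  finally have 1: "0 \<le> (g + k) \<bullet> e / 2 - 3/4 * (\<Phi> e \<bullet> e) + (k - g) \<bullet> M (k - g) / 4
      - M (lie (M u) u) \<bullet> lie (M v) v" .
  have "0 \<le> \<Phi> (e - M (g + k)) \<bullet> (e - M (g + k))" by (rule Phi_nonneg)
  also have "\<dots> = \<Phi> e \<bullet> e - 2 * ((g + k) \<bullet> e) + M (g + k) \<bullet> (g + k)"
  proof -
    have "\<Phi> e \<bullet> M (g + k) = (g + k) \<bullet> e" by (metis M_selfadj inner_commute left)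
    then show ?thesis
      unfolding linear_diff[OF linear_Phi] right inner_diff_left inner_diff_right
        inner_commute[of "g + k" "M (g + k)"] by simp
  qed
  finally have 2: "\<Phi> e \<bullet> e \<ge> 2 * ((g + k) \<bullet> e) - M (g + k) \<bullet> (g + k)" by simp
  have "M k \<bullet> g = M g \<bullet> k" by (metis M_selfadj inner_commute)
  \<comment> \<open>The weight 3/4 comes from the completed square and 1/4 from Puettmann's formula;
    together they leave the form <M g, g> + <M k, k> + <M g, k>.\<close>
  then have 3: "3/4 * (M (g + k) \<bullet> (g + k)) + (k - g) \<bullet> M (k - g) / 4 =
      M g \<bullet> g + M k \<bullet> k + M g \<bullet> k"
    unfolding inner_commute[of "k - g" "M (k - g)"]
    by (simp add: MS inner_simps field_simps)
  show ?thesis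
    using 1 2 3 unfolding cubic_curv_def Let_def g_def[symmetric] k_def[symmetric] e_def[symmetric]
    by (simp add: field_simps)
qed

subsection \<open>The cubic in adapted frames\<close>

text \<open>Complete bracket and inner product tables for oriented orthonormal frames of two
  commuting copies of so(3). With them the simplifier evaluates the cubic on explicit
  vectors.\<close>

locale so4_frame =
  fixes U1 U2 U3 V1 V2 V3 :: so4
  assumes lie_frame:
      "lie U1 U2 = U3" "lie U2 U3 = U1" "lie U3 U1 = U2"
      "lie U2 U1 = - U3" "lie U3 U2 = - U1" "lie U1 U3 = - U2"
      "lie V1 V2 = V3" "lie V2 V3 = V1" "lie V3 V1 = V2"
      "lie V2 V1 = - V3" "lie V3 V2 = - V1" "lie V1 V3 = - V2"
      "lie U1 V1 = 0" "lie U1 V2 = 0" "lie U1 V3 = 0" "lie U2 V1 = 0"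
      "lie U2 V2 = 0" "lie U2 V3 = 0" "lie U3 V1 = 0" "lie U3 V2 = 0"
      "lie U3 V3 = 0" "lie V1 U1 = 0" "lie V2 U1 = 0" "lie V3 U1 = 0"
      "lie V1 U2 = 0" "lie V2 U2 = 0" "lie V3 U2 = 0" "lie V1 U3 = 0"
      "lie V2 U3 = 0" "lie V3 U3 = 0"
    and inner_frame:
      "U1 \<bullet> U1 = 1" "U1 \<bullet> U2 = 0" "U1 \<bullet> U3 = 0" "U1 \<bullet> V1 = 0"
      "U1 \<bullet> V2 = 0" "U1 \<bullet> V3 = 0" "U2 \<bullet> U1 = 0" "U2 \<bullet> U2 = 1"
      "U2 \<bullet> U3 = 0" "U2 \<bullet> V1 = 0" "U2 \<bullet> V2 = 0" "U2 \<bullet> V3 = 0"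
      "U3 \<bullet> U1 = 0" "U3 \<bullet> U2 = 0" "U3 \<bullet> U3 = 1" "U3 \<bullet> V1 = 0"
      "U3 \<bullet> V2 = 0" "U3 \<bullet> V3 = 0" "V1 \<bullet> U1 = 0" "V1 \<bullet> U2 = 0"
      "V1 \<bullet> U3 = 0" "V1 \<bullet> V1 = 1" "V1 \<bullet> V2 = 0" "V1 \<bullet> V3 = 0"
      "V2 \<bullet> U1 = 0" "V2 \<bullet> U2 = 0" "V2 \<bullet> U3 = 0" "V2 \<bullet> V1 = 0"
      "V2 \<bullet> V2 = 1" "V2 \<bullet> V3 = 0" "V3 \<bullet> U1 = 0" "V3 \<bullet> U2 = 0"
      "V3 \<bullet> U3 = 0" "V3 \<bullet> V1 = 0" "V3 \<bullet> V2 = 0" "V3 \<bullet> V3 = 1"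

text \<open>The shape of the inverse matrix when U1 is an eigenvector and the bases of the two factors
  are singular bases of its off-diagonal block.\<close>
locale singular_frame = so4_frame +
  fixes M :: "so4 \<Rightarrow> so4" and mu s22 s23 s33 sg ta t11 t12 t13 t22 t23 t33 :: real
  assumes lin: "linear M"
    and M_frame: "M U1 = mu *\<^sub>R U1"
      "M U2 = s22 *\<^sub>R U2 + s23 *\<^sub>R U3 + ta *\<^sub>R V3"
      "M U3 = s23 *\<^sub>R U2 + s33 *\<^sub>R U3 + sg *\<^sub>R V1"
      "M V1 = sg *\<^sub>R U3 + t11 *\<^sub>R V1 + t12 *\<^sub>R V2 + t13 *\<^sub>R V3"
      "M V2 = t12 *\<^sub>R V1 + t22 *\<^sub>R V2 + t23 *\<^sub>R V3"
      "M V3 = ta *\<^sub>R U2 + t13 *\<^sub>R V1 + t23 *\<^sub>R V2 + t33 *\<^sub>R V3"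
    and cubic: "\<And>u v. cubic_curv M u v \<ge> 0"
    and sg: "sg > 0"
begin

lemmas MS = linear_add[OF lin] linear_diff[OF lin] linear_scale[OF lin]
  linear_neg[OF lin] linear_0[OF lin]

lemmas frame_simps = cubic_curv_def Let_def MS M_frame lie_simps lie_frame inner_frame
  inner_add_left inner_add_right inner_diff_left inner_diff_right

text \<open>Diagonal entries enter only through differences within a block. The free \<eta> gives a
  quadratic whose linear coefficient isolates \<open>s23\<close>; its value at \<eta> = 0 controls
  \<open>s22\<close>.\<close>

lemma cubic_U1V1_V3: "0 \<le> sg\<^sup>2 * (s22 - mu) - 2 * \<eta> * sg * ta * s23 + \<eta>\<^sup>2 * ta\<^sup>2 * (s33 - mu)"
  using cubic[of U1 "V1 + \<eta> *\<^sub>R V3"]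
  by (simp add: frame_simps) (simp add: algebra_simps power2_eq_square)

lemma cubic_U1V3: "0 \<le> ta\<^sup>2 * (s33 - mu)"
  using cubic[of U1 V3]
  by (simp add: frame_simps) (simp add: algebra_simps power2_eq_square)

text \<open>This value is minus the sum of those at U1, V1 and at U2, V2, so nonnegativity makes all
  three vanish.\<close>

lemma cubic_U2V1: "0 \<le> sg\<^sup>2 * (mu - s22) + ta\<^sup>2 * (t22 - t11)"
  using cubic[of U2 V1]
  by (simp add: frame_simps) (simp add: algebra_simps power2_eq_square)

text \<open>In the same way this is minus the sum of the values at U1, V3 and at U3, V2.\<close>

lemma cubic_U3V3: "0 \<le> ta\<^sup>2 * (mu - s33) + sg\<^sup>2 * (t22 - t33)"
  using cubic[of U3 V3]
  by (simp add: frame_simps) (simp add: algebra_simps power2_eq_square)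

lemma cubic_U2V2: "0 \<le> ta\<^sup>2 * (t11 - t22)"
  using cubic[of U2 V2]
  by (simp add: frame_simps) (simp add: algebra_simps power2_eq_square)

lemma cubic_U3V2: "0 \<le> sg\<^sup>2 * (t33 - t22)"
  using cubic[of U3 V2]
  by (simp add: frame_simps) (simp add: algebra_simps power2_eq_square)

lemma s22_ge: "s22 \<ge> mu"
  using cubic_U1V1_V3[of 0] sg by (simp add: zero_le_mult_iff)

lemma t33_ge: "t33 \<ge> t22"
  using cubic_U3V2 sg by (simp add: zero_le_mult_iff)

lemma sg_cancel: "sg\<^sup>2 * x \<le> 0 \<longleftrightarrow> x \<le> 0" "0 \<le> sg\<^sup>2 * x \<longleftrightarrow> 0 \<le> x"
  using sg by (auto simp: mult_le_0_iff zero_le_mult_iff)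

text \<open>The off-diagonal block has rank at most one: otherwise the six planes above force the
  diagonal blocks to be scalar on the images of the off-diagonal one, and the curvature becomes
  negative near the flat plane spanned by U1 and V2.\<close>
lemma ta_eq_0: "ta = 0"
proof (rule ccontr)
  assume ta: "ta \<noteq> 0"
  then have t11: "t11 \<ge> t22" and s33: "s33 \<ge> mu"
    using cubic_U2V2 cubic_U1V3 by (auto simp: zero_le_mult_iff)
  have "0 \<le> ta\<^sup>2 * (t11 - t22)" "0 \<le> sg\<^sup>2 * (s22 - mu)"
    using cubic_U2V2 cubic_U1V1_V3[of 0] by simp_all
  moreover have "0 \<le> sg\<^sup>2 * (mu - s22) + ta\<^sup>2 * (t22 - t11)" by (rule cubic_U2V1)
  ultimately have "ta\<^sup>2 * (t11 - t22) = 0" "sg\<^sup>2 * (s22 - mu) = 0"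
    unfolding right_diff_distrib by linarith+
  then have e1: "t11 = t22" "s22 = mu" using ta sg by simp_all
  have "0 \<le> ta\<^sup>2 * (s33 - mu)" "0 \<le> sg\<^sup>2 * (t33 - t22)"
    by (rule cubic_U1V3 cubic_U3V2)+
  moreover have "0 \<le> ta\<^sup>2 * (mu - s33) + sg\<^sup>2 * (t22 - t33)" by (rule cubic_U3V3)
  ultimately have "ta\<^sup>2 * (s33 - mu) = 0" "sg\<^sup>2 * (t33 - t22) = 0"
    unfolding right_diff_distrib by linarith+
  then have e2: "s33 = mu" "t33 = t22" using ta sg by simp_all
  have "sg * ta * s23 = 0"
    using cubic_U1V1_V3[of 1] cubic_U1V1_V3[of "-1"] by (auto simp: e1 e2)
  then have e3: "s23 = 0" using ta sg by auto
  \<comment> \<open>The expression is odd in \<eta>, so it vanishes identically; the parity in \<xi>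
    then separates \<open>ta\<close> from \<open>t12\<close>.\<close>
  have Q: "0 \<le> sg\<^sup>2 * (- \<xi> * \<eta> * ta - \<xi>\<^sup>2 * \<eta> * t12)" for \<xi> \<eta>
    using cubic[of "U1 + \<xi> *\<^sub>R U3" "V2 + \<eta> *\<^sub>R V1"]
    by (simp add: frame_simps e1 e2 e3) (simp add: algebra_simps power2_eq_square)
  have "ta = 0"
    using Q[of 1 1] Q[of 1 "-1"] Q[of "-1" 1] Q[of "-1" "-1"] by (simp add: sg_cancel)
  with ta show False by simp
qed

text \<open>Once \<open>ta\<close> vanishes, the cubic at U2, V1 is the negative of the cubic at U1,
  V1.\<close>

lemma s22_eq: "s22 = mu"
  using s22_ge cubic_U2V1 by (simp add: ta_eq_0 sg_cancel)

lemma t33_eq: "t33 = t22"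
  using t33_ge cubic_U3V3 by (simp add: ta_eq_0 sg_cancel)

text \<open>The cubic now vanishes at U2, V1, and tilting U2 towards U3 changes it by a purely
  linear term, which must be zero.\<close>

lemma s23_eq_0: "s23 = 0"
proof -
  have Q: "0 \<le> sg\<^sup>2 * (- \<xi> * s23)" for \<xi>
    using cubic[of "U2 + \<xi> *\<^sub>R U3" V1]
    by (simp add: frame_simps ta_eq_0 s22_eq) (simp add: algebra_simps power2_eq_square)
  show ?thesis
    using Q[of 1] Q[of "-1"] by (simp add: sg_cancel)
qed

text \<open>With U3 fixed, the cubic is a quadratic form in the second vector without square terms;
  such a form is nonnegative only if it is zero.\<close>

lemma t_off_diagonal: "t12 = 0" "t13 = 0" "t23 = 0"
proof -
  have Q: "0 \<le> sg\<^sup>2 * (- \<beta>1 * (\<beta>2 * t12 + \<beta>3 * t13) - 4 * t23 * \<beta>2 * \<beta>3)" for \<beta>1 \<beta>2 \<beta>3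
    using cubic[of U3 "\<beta>1 *\<^sub>R V1 + \<beta>2 *\<^sub>R V2 + \<beta>3 *\<^sub>R V3"]
    by (simp add: frame_simps ta_eq_0 s22_eq t33_eq s23_eq_0)
       (simp add: algebra_simps power2_eq_square)
  show "t12 = 0" using Q[of 1 1 0] Q[of 1 "-1" 0] by (simp add: sg_cancel)
  show "t13 = 0" using Q[of 1 0 1] Q[of 1 0 "-1"] by (simp add: sg_cancel)
  show "t23 = 0" using Q[of 0 1 1] Q[of 0 1 "-1"] by (simp add: sg_cancel)
qed

end

subsection \<open>Construction of adapted frames\<close>

text \<open>Taking \<open>w\<close> as a cross product builds in the orientation that the bracket
  tables require.\<close>

definition oriented_frame :: "real^3 \<Rightarrow> real^3 \<Rightarrow> real^3 \<Rightarrow> bool" where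
  "oriented_frame u v w \<longleftrightarrow> u \<bullet> u = 1 \<and> v \<bullet> v = 1 \<and> u \<bullet> v = 0 \<and> w = cross3 u v"

lemma oriented_frameD:
  assumes "oriented_frame u v w"
  shows "u \<bullet> u = 1" "v \<bullet> v = 1" "w \<bullet> w = 1" "u \<bullet> v = 0" "v \<bullet> u = 0" "u \<bullet> w = 0"
    "w \<bullet> u = 0" "v \<bullet> w = 0" "w \<bullet> v = 0"
    "cross3 u v = w" "cross3 v w = u" "cross3 w u = v"
    "cross3 v u = - w" "cross3 w v = - u" "cross3 u w = - v"
proof -
  have uv: "u \<bullet> u = 1" "v \<bullet> v = 1" "u \<bullet> v = 0" "v \<bullet> u = 0" "cross3 u v = w"
    using assms by (auto simp: oriented_frame_def inner_commute)
  then show "u \<bullet> u = 1" "v \<bullet> v = 1" "u \<bullet> v = 0" "v \<bullet> u = 0" "cross3 u v = w" by auto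
  show "u \<bullet> w = 0" "v \<bullet> w = 0" "w \<bullet> u = 0" "w \<bullet> v = 0"
    using uv(5) dot_cross_self[of u v] dot_cross_self[of v u] by (auto simp: inner_commute)
  show vw: "cross3 v w = u" unfolding uv(5)[symmetric] Lagrange by (simp add: uv)
  have uw: "cross3 u w = - v" unfolding uv(5)[symmetric] Lagrange by (simp add: uv)
  then show "cross3 u w = - v" .
  show "cross3 w u = v" "cross3 v u = - w" "cross3 w v = - u"
    using uw vw uv(5) cross_skew[of w u] cross_skew[of v u] cross_skew[of w v] by auto
  have "(norm w)\<^sup>2 + (u \<bullet> v)\<^sup>2 = (norm u * norm v)\<^sup>2"
    unfolding uv(5)[symmetric] by (rule norm_cross_dot)
  then show "w \<bullet> w = 1" using uv by (simp add: power_mult_distrib power2_norm_eq_inner)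
qed

lemma oriented_frame_rotate:
  assumes "oriented_frame u v w"
  shows "oriented_frame v w u" "oriented_frame w u v"
  using oriented_frameD[OF assms] by (simp_all add: oriented_frame_def)

text \<open>The remainder of the expansion is orthogonal to \<open>w\<close>, and its cross product
  with \<open>w\<close> is zero by the triple product identity, so it vanishes.\<close>

lemma oriented_frame_expand:
  assumes "oriented_frame u v w"
  shows "x = (x \<bullet> u) *\<^sub>R u + (x \<bullet> v) *\<^sub>R v + (x \<bullet> w) *\<^sub>R w"
proof -
  note f = oriented_frameD[OF assms]
  define y where "y = x - ((x \<bullet> u) *\<^sub>R u + (x \<bullet> v) *\<^sub>R v + (x \<bullet> w) *\<^sub>R w)"
  have y: "y \<bullet> u = 0" "y \<bullet> v = 0" "y \<bullet> w = 0"
    by (simp_all add: y_def inner_diff_left inner_add_left f)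
  have "cross3 y w = 0"
    unfolding f(10)[symmetric] Lagrange by (simp add: y)
  then have "y = 0 \<or> w = 0" using y(3) norm_and_cross_eq_0 by blast
  moreover have "w \<noteq> 0" using f(3) by auto
  ultimately show ?thesis by (simp add: y_def)
qed

lemma oriented_frame_imp_orthonormal_basis3:
  assumes "oriented_frame u v w"
  shows "orthonormal_basis3 u v w"
proof -
  have "x \<in> span {u, v, w}" for x
    by (subst oriented_frame_expand[OF assms, of x]) (intro span_add span_scale span_base; simp)
  then show ?thesis
    using oriented_frameD[OF assms] by (auto simp: orthonormal_basis3_def)
qed

lemma so4_frame_oriented_frames:
  assumes "oriented_frame A1 A2 A3" "oriented_frame B1 B2 B3"
  shows "so4_frame (A1, 0) (A2, 0) (A3, 0) (0, B1) (0, B2) (0, B3)"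
  by unfold_locales
     (simp_all add: lie_def oriented_frameD[OF assms(1)] oriented_frameD[OF assms(2)] zero_prod_def)

lemma so4_expand:
  assumes "oriented_frame A1 A2 A3" "oriented_frame B1 B2 B3"
  shows "Z = (Z \<bullet> (A1, 0)) *\<^sub>R (A1, 0) + (Z \<bullet> (A2, 0)) *\<^sub>R (A2, 0) + (Z \<bullet> (A3, 0)) *\<^sub>R (A3, 0)
    + (Z \<bullet> (0, B1)) *\<^sub>R (0, B1) + (Z \<bullet> (0, B2)) *\<^sub>R (0, B2) + (Z \<bullet> (0, B3)) *\<^sub>R (0, B3)"
  using oriented_frame_expand[OF assms(1), of "fst Z"] oriented_frame_expand[OF assms(2), of "snd Z"]
  by (simp add: prod_eq_iff inner_prod_def)

text \<open>One step of a singular value decomposition: \<open>u\<close> maximises the stretch on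
  the unit sphere, and orthogonality is the first variation of |f (u + t x)| \<le> |f u| |u + t x|
  at t = 0.\<close>

lemma linear_max_stretch_orthogonal:
  fixes f :: "'a::euclidean_space \<Rightarrow> 'b::real_inner"
  assumes f: "linear f"
  obtains u where "norm u = 1" "\<And>x. norm (f x) \<le> norm (f u) * norm x"
    "\<And>x. x \<bullet> u = 0 \<Longrightarrow> f x \<bullet> f u = 0"
proof -
  have "continuous_on (sphere 0 1) (\<lambda>x. norm (f x))"
    using f by (intro continuous_intros linear_continuous_on)
      (simp add: linear_conv_bounded_linear)
  moreover have "compact (sphere (0::'a) 1)" "sphere (0::'a) 1 \<noteq> {}" by auto
  ultimately obtain u where u: "u \<in> sphere 0 1" "\<And>x. x \<in> sphere 0 1 \<Longrightarrow> norm (f x) \<le> norm (f u)"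
    using continuous_attains_sup by meson
  have bound: "norm (f x) \<le> norm (f u) * norm x" for x
  proof (cases "x = 0")
    case True
    then show ?thesis by (simp add: linear_0[OF f])
  next
    case False
    then have "norm (f (x /\<^sub>R norm x)) \<le> norm (f u)" by (intro u(2)) simp
    then show ?thesis using False by (simp add: linear_scale[OF f] field_simps)
  qed
  have orth: "f x \<bullet> f u = 0" if x: "x \<bullet> u = 0" for x
  proof -
    define K where "K = (norm (f u) * norm x)\<^sup>2"
    have *: "2 * t * (f x \<bullet> f u) \<le> K * t\<^sup>2" for t
    proof -
      have "(norm (f u))\<^sup>2 + 2 * t * (f x \<bullet> f u) + t\<^sup>2 * (norm (f x))\<^sup>2 = (norm (f (u + t *\<^sub>R x)))\<^sup>2"
        unfolding power2_norm_eq_inner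
        by (simp add: inner_simps inner_commute power2_eq_square linear_add[OF f] linear_scale[OF f])
      also have "\<dots> \<le> (norm (f u) * norm (u + t *\<^sub>R x))\<^sup>2"
        by (intro power_mono bound) simp
      also have "\<dots> = (norm (f u))\<^sup>2 * (norm (u + t *\<^sub>R x))\<^sup>2" by (rule power_mult_distrib)
      also have "(norm (u + t *\<^sub>R x))\<^sup>2 = 1 + t\<^sup>2 * (norm x)\<^sup>2"
        using u(1) x unfolding power2_norm_eq_inner
        by (simp add: inner_simps inner_commute norm_eq_1 power2_eq_square)
      also have "(norm (f u))\<^sup>2 * \<dots> = (norm (f u))\<^sup>2 + K * t\<^sup>2"
        by (simp add: K_def power_mult_distrib algebra_simps)
      finally have "2 * t * (f x \<bullet> f u) + t\<^sup>2 * (norm (f x))\<^sup>2 \<le> K * t\<^sup>2" by simp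
      moreover have "0 \<le> t\<^sup>2 * (norm (f x))\<^sup>2" by simp
      ultimately show ?thesis by linarith
    qed
    define y where "y = f x \<bullet> f u"
    have K: "K \<ge> 0" by (simp add: K_def)
    \<comment> \<open>This \<open>t\<close> is small enough for the linear term to beat the
      quadratic one; K + 1 avoids a zero denominator.\<close>
    have "2 * (y / (K + 1)) * y \<le> K * (y / (K + 1))\<^sup>2"
      using *[of "y / (K + 1)"] by (simp add: y_def)
    then have "2 * (K + 1) * y\<^sup>2 \<le> K * y\<^sup>2"
      using K by (simp add: divide_simps power2_eq_square split: if_splits) (simp add: algebra_simps)
    then have "(K + 2) * y\<^sup>2 \<le> 0" by (simp add: algebra_simps)
    then show ?thesis using K by (simp add: mult_le_0_iff y_def)
  qed
  show ?thesis using that u(1) bound orth by simp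
qed

lemma exists_unit_orthogonal2:
  fixes p q :: "real^3"
  obtains x where "x \<bullet> x = 1" "x \<bullet> p = 0" "x \<bullet> q = 0"
proof -
  have "dim {p, q} \<le> card {p, q}" by (rule dim_le_card') simp
  also have "\<dots> < DIM(real^3)" by (simp add: card_insert_if)
  finally obtain x where x: "x \<noteq> 0" "\<And>y. y \<in> span {p, q} \<Longrightarrow> orthogonal x y"
    using orthogonal_to_subspace_exists by blast
  then have "x \<bullet> p = 0" "x \<bullet> q = 0"
    using span_base[of p "{p, q}"] span_base[of q "{p, q}"] by (simp_all add: orthogonal_def)
  then show ?thesis
    using x(1) by (intro that[of "x /\<^sub>R norm x"]) (simp_all add: dot_square_norm power2_eq_square)
qed

section \<open>Rigidity of matrices with nonnegative cubic and a singular eigenvector\<close>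

definition block_diagonal :: "(so4 \<Rightarrow> so4) \<Rightarrow> bool" where
  "block_diagonal M \<longleftrightarrow> (\<forall>x. snd (M (x, 0)) = 0) \<and> (\<forall>x. fst (M (0, x)) = 0)"

text \<open>Self-adjointness of M then makes the plane spanned by A3 and B1 invariant.\<close>
definition torus_form :: "(so4 \<Rightarrow> so4) \<Rightarrow> bool" where
  "torus_form M \<longleftrightarrow> (\<exists>A1 A2 A3 B1 B2 B3 c d.
     oriented_frame A1 A2 A3 \<and> oriented_frame B1 B2 B3 \<and>
     M (A1, 0) = c *\<^sub>R (A1, 0) \<and> M (A2, 0) = c *\<^sub>R (A2, 0) \<and>
     M (0, B2) = d *\<^sub>R (0, B2) \<and> M (0, B3) = d *\<^sub>R (0, B3))"

text \<open>If the off-diagonal block is nonzero, the frames are built from the eigenvector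
  \<open>A1\<close>, the most stretched direction \<open>B1\<close> of the block and its normalised
  image \<open>A3\<close>; the results on singular frames then apply.\<close>

lemma cubic_curv_rigidity_fst:
  assumes lin: "linear M"
    and adj: "\<And>X Y. M X \<bullet> Y = X \<bullet> M Y"
    and cubic: "\<And>u v. cubic_curv M u v \<ge> 0"
    and v: "v \<noteq> 0" "M (v, 0) = mu *\<^sub>R (v, 0)"
  shows "block_diagonal M \<or> torus_form M"
proof -
  \<comment> \<open>\<open>C\<close> is the block from the second factor to the first; its adjoint
    sends a to \<open>snd (M (a, 0))\<close>.\<close>
  define C where "C = (\<lambda>b. fst (M (0, b)))"
  have linC: "linear C"
    by (rule linearI) (simp_all add: C_def linear_add[OF lin, symmetric] linear_scale[OF lin, symmetric]
        flip: fst_add fst_scaleR)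
  have C_adj: "snd (M (a, 0)) \<bullet> b = a \<bullet> C b" for a b
    using adj[of "(a, 0)" "(0, b)"] by (simp add: inner_prod_def C_def)
  obtain B1 where B1: "norm B1 = 1" "\<And>x. norm (C x) \<le> norm (C B1) * norm x"
      "\<And>x. x \<bullet> B1 = 0 \<Longrightarrow> C x \<bullet> C B1 = 0"
    using linear_max_stretch_orthogonal[OF linC] by blast
  show ?thesis
  proof (cases "C B1 = 0")
    case True
    then have C0: "C x = 0" for x using B1(2)[of x] by simp
    have "snd (M (x, 0)) = 0" for x
      using C_adj[of x "snd (M (x, 0))"] by (simp add: C0)
    then show ?thesis using C0 by (simp add: block_diagonal_def C_def)
  next
    case False
    define sg where "sg = norm (C B1)"
    have sg: "sg > 0" using False by (simp add: sg_def)
    define A1 where "A1 = v /\<^sub>R norm v"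
    define A3 where "A3 = C B1 /\<^sub>R sg"
    define A2 where "A2 = cross3 A3 A1"
    have MA1: "M (A1, 0) = mu *\<^sub>R (A1, 0)"
      using v linear_scale[OF lin, of "inverse (norm v)" "(v, 0)"] by (simp add: A1_def)
    have A1C: "A1 \<bullet> C b = 0" for b
      using C_adj[of A1 b] by (simp add: MA1)
    have "oriented_frame A3 A1 A2"
      using v(1) False A1C[of B1]
      by (simp add: oriented_frame_def A2_def)
         (simp add: A1_def A3_def sg_def dot_square_norm power2_eq_square inner_commute)
    then have fA: "oriented_frame A1 A2 A3" by (rule oriented_frame_rotate)
    \<comment> \<open>Orthogonality to the adjoint image of \<open>A2\<close> kills the coupling of
      \<open>A2\<close> with \<open>B2\<close>, so that \<open>A2\<close> can couple only with
      \<open>B3\<close>.\<close>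
    obtain B2 where B2: "B2 \<bullet> B2 = 1" "B2 \<bullet> B1 = 0" "B2 \<bullet> snd (M (A2, 0)) = 0"
      using exists_unit_orthogonal2 by blast
    define B3 where "B3 = cross3 B1 B2"
    have fB: "oriented_frame B1 B2 B3"
      using B1(1) B2 by (simp add: oriented_frame_def B3_def norm_eq_1 inner_commute)
    note f = oriented_frameD[OF fA] oriented_frameD[OF fB]
    have CB1: "C B1 = sg *\<^sub>R A3" using sg by (simp add: A3_def)
    have A3C: "A3 \<bullet> C b = 0" if "b \<bullet> B1 = 0" for b
      using B1(3)[OF that] by (simp add: A3_def inner_commute)
    have A2C: "A2 \<bullet> C B2 = 0" using C_adj[of A2 B2] B2(3) by (simp add: inner_commute)
    have UV: "M (a, 0) \<bullet> (0, b) = a \<bullet> C b" "M (0, b) \<bullet> (a, 0) = a \<bullet> C b" for a b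
      using C_adj[of a b] by (simp_all add: inner_prod_def C_def inner_commute)
    have U1: "M X \<bullet> (A1, 0) = mu * (X \<bullet> (A1, 0))" "M (A1, 0) \<bullet> X = mu * (X \<bullet> (A1, 0))" for X
      using adj[of X "(A1, 0)"] by (simp_all add: MA1 inner_commute del: scaleR_Pair)
    have sym: "M X \<bullet> Y = M Y \<bullet> X" for X Y
      using adj[of X Y] by (simp add: inner_commute)
    interpret singular_frame "(A1, 0)" "(A2, 0)" "(A3, 0)" "(0, B1)" "(0, B2)" "(0, B3)" M mu
      "M (A2, 0) \<bullet> (A2, 0)" "M (A2, 0) \<bullet> (A3, 0)" "M (A3, 0) \<bullet> (A3, 0)" sg "A2 \<bullet> C B3"
      "M (0, B1) \<bullet> (0, B1)" "M (0, B1) \<bullet> (0, B2)" "M (0, B1) \<bullet> (0, B3)"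
      "M (0, B2) \<bullet> (0, B2)" "M (0, B2) \<bullet> (0, B3)" "M (0, B3) \<bullet> (0, B3)"
    proof (intro singular_frame.intro singular_frame_axioms.intro)
      show "so4_frame (A1, 0) (A2, 0) (A3, 0) (0, B1) (0, B2) (0, B3)"
        by (rule so4_frame_oriented_frames[OF fA fB])
      note simps = UV U1 f CB1 A3C A2C A1C
      show "M (A2, 0) = (M (A2, 0) \<bullet> (A2, 0)) *\<^sub>R (A2, 0) + (M (A2, 0) \<bullet> (A3, 0)) *\<^sub>R (A3, 0)
          + (A2 \<bullet> C B3) *\<^sub>R (0, B3)"
        by (subst so4_expand[OF fA fB, of "M (A2, 0)"]) (simp add: simps)
      show "M (A3, 0) = (M (A2, 0) \<bullet> (A3, 0)) *\<^sub>R (A2, 0) + (M (A3, 0) \<bullet> (A3, 0)) *\<^sub>R (A3, 0)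
          + sg *\<^sub>R (0, B1)"
        by (subst so4_expand[OF fA fB, of "M (A3, 0)"]) (simp add: simps sym[of "(A3, 0)" "(A2, 0)"])
      show "M (0, B1) = sg *\<^sub>R (A3, 0) + (M (0, B1) \<bullet> (0, B1)) *\<^sub>R (0, B1)
          + (M (0, B1) \<bullet> (0, B2)) *\<^sub>R (0, B2) + (M (0, B1) \<bullet> (0, B3)) *\<^sub>R (0, B3)"
        by (subst so4_expand[OF fA fB, of "M (0, B1)"]) (simp add: simps)
      show "M (0, B2) = (M (0, B1) \<bullet> (0, B2)) *\<^sub>R (0, B1)
          + (M (0, B2) \<bullet> (0, B2)) *\<^sub>R (0, B2) + (M (0, B2) \<bullet> (0, B3)) *\<^sub>R (0, B3)"
        by (subst so4_expand[OF fA fB, of "M (0, B2)"]) (simp add: simps sym[of "(0, B2)" "(0, B1)"])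
      show "M (0, B3) = (A2 \<bullet> C B3) *\<^sub>R (A2, 0) + (M (0, B1) \<bullet> (0, B3)) *\<^sub>R (0, B1)
          + (M (0, B2) \<bullet> (0, B3)) *\<^sub>R (0, B2) + (M (0, B3) \<bullet> (0, B3)) *\<^sub>R (0, B3)"
        by (subst so4_expand[OF fA fB, of "M (0, B3)"])
           (simp add: simps sym[of "(0, B3)" "(0, B1)"] sym[of "(0, B3)" "(0, B2)"])
    qed (use lin MA1 cubic sg in auto)
    have "M (A2, 0) = mu *\<^sub>R (A2, 0)"
      using M_frame(2) unfolding ta_eq_0 s22_eq s23_eq_0 by simp
    moreover have "M (0, B2) = (M (0, B2) \<bullet> (0, B2)) *\<^sub>R (0, B2)"
      using M_frame(5) unfolding t_off_diagonal by simp
    moreover have "M (0, B3) = (M (0, B2) \<bullet> (0, B2)) *\<^sub>R (0, B3)"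
      using M_frame(6) unfolding t_off_diagonal ta_eq_0 t33_eq by simp
    ultimately show ?thesis using MA1 fA fB unfolding torus_form_def by blast
  qed
qed

section \<open>Exchange of the two factors\<close>

lemma swap_add: "prod.swap (X + Y) = prod.swap X + prod.swap Y"
  and swap_scaleR: "prod.swap (r *\<^sub>R X) = r *\<^sub>R prod.swap X"
  for X Y :: so4
  by (simp_all add: prod_eq_iff)

lemma lie_swap: "lie (prod.swap X) (prod.swap Y) = prod.swap (lie X Y)"
  by (simp add: lie_def prod.swap_def)

lemma inner_swap: "prod.swap X \<bullet> Y = X \<bullet> prod.swap (Y :: so4)"
  by (simp add: inner_prod_def)

text \<open>The exchange is an isometric Lie algebra automorphism, and the cubic is built from
  brackets, inner products and \<open>M\<close> alone.\<close>

lemma cubic_curv_swap: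
  "cubic_curv (\<lambda>X. prod.swap (M (prod.swap X))) u v = cubic_curv M (prod.swap u) (prod.swap v)"
proof -
  have swap: "lie u (prod.swap Z) = prod.swap (lie (prod.swap u) Z)"
    "lie (prod.swap Z) u = prod.swap (lie Z (prod.swap u))"
    "lie (prod.swap Z) v = prod.swap (lie Z (prod.swap v))" for Z
    using lie_swap[of "prod.swap u" Z] lie_swap[of Z "prod.swap u"] lie_swap[of Z "prod.swap v"]
    by simp_all
  show ?thesis
    by (simp add: cubic_curv_def Let_def swap lie_swap flip: swap_add)
       (simp add: inner_swap)
qed

text \<open>An eigenvector in the second factor is moved to the first by conjugating
  \<open>M\<close> with the exchange; both normal forms are invariant under it.\<close>

lemma cubic_curv_rigidity:
  assumes lin: "linear M"
    and adj: "\<And>X Y. M X \<bullet> Y = X \<bullet> M Y"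
    and cubic: "\<And>u v. cubic_curv M u v \<ge> 0"
    and v: "v \<noteq> 0" "singular v" "M v = mu *\<^sub>R v"
  shows "block_diagonal M \<or> torus_form M"
proof (cases "v \<in> g1")
  case True
  then have "v = (fst v, 0)" by (simp add: g1_def prod_eq_iff)
  then show ?thesis
    using cubic_curv_rigidity_fst[OF lin adj cubic, of "fst v" mu] v by (metis zero_prod_def)
next
  case False
  then have v2: "v = (0, snd v)" using v(2) by (simp add: singular_def g2_def prod_eq_iff)
  define N where "N = (\<lambda>X. prod.swap (M (prod.swap X)))"
  have "block_diagonal N \<or> torus_form N"
  proof (rule cubic_curv_rigidity_fst)
    show "linear N"
      by (rule linearI) (simp_all add: N_def swap_add swap_scaleR linear_add[OF lin] linear_scale[OF lin])
    show "N X \<bullet> Y = X \<bullet> N Y" for X Y by (simp add: N_def inner_swap adj)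
    show "cubic_curv N u w \<ge> 0" for u w by (simp add: N_def cubic_curv_swap cubic)
    show "snd v \<noteq> 0" using v(1) v2 by (metis zero_prod_def)
    show "N (snd v, 0) = mu *\<^sub>R (snd v, 0)"
      using v(3) v2 by (simp add: N_def) (metis fst_conv scaleR_Pair scaleR_zero_right swap_simp)
  qed
  moreover have "block_diagonal M" if "block_diagonal N"
    using that by (simp add: block_diagonal_def N_def)
  moreover have "torus_form M" if N_torus: "torus_form N"
  proof -
    have M: "M X = prod.swap (N (prod.swap X))" for X by (simp add: N_def)
    obtain A1 A2 A3 B1 B2 B3 c d where fr: "oriented_frame A1 A2 A3" "oriented_frame B1 B2 B3"
      and N: "N (A1, 0) = c *\<^sub>R (A1, 0)" "N (A2, 0) = c *\<^sub>R (A2, 0)"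
        "N (0, B2) = d *\<^sub>R (0, B2)" "N (0, B3) = d *\<^sub>R (0, B3)"
      using N_torus unfolding torus_form_def by blast
    have "M (B2, 0) = d *\<^sub>R (B2, 0)" "M (B3, 0) = d *\<^sub>R (B3, 0)"
      "M (0, A1) = c *\<^sub>R (0, A1)" "M (0, A2) = c *\<^sub>R (0, A2)"
      unfolding M swap_simp N by simp_all
    \<comment> \<open>The coupled pair must again be the third vector of the first frame and the
      first of the second, hence the frames \<open>B2\<close>, \<open>B3\<close>, \<open>B1\<close>
      and \<open>A3\<close>, \<open>A1\<close>, \<open>A2\<close>.\<close>
    then show ?thesis
      unfolding torus_form_def
      using oriented_frame_rotate(1)[OF fr(2)] oriented_frame_rotate(2)[OF fr(1)] by blast
  qed
  ultimately show ?thesis by blast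
qed

subsection \<open>Back to the metric\<close>

context metric_inverse
begin

lemma Phi_eigen:
  assumes "M U = c *\<^sub>R U" "U \<noteq> 0"
  shows "\<Phi> U = (1 / c) *\<^sub>R U"
proof -
  have "U = c *\<^sub>R \<Phi> U" using right[of U] by (simp add: assms(1) PhiS)
  then show ?thesis using assms(2) by (metis divideR_right scaleR_one inverse_eq_divide scaleR_zero_left)
qed

text \<open>For \<open>X\<close> in one factor, the component of \<Phi> X in the other factor is
  killed by \<open>M\<close>, which is injective.\<close>

lemma product_case:
  assumes "block_diagonal M"
  shows "\<Phi> ` g1 \<subseteq> g1" "\<Phi> ` g2 \<subseteq> g2"
proof -
  have split: "M X = M (fst X, 0) + M (0, snd X)" for X
    by (simp flip: linear_add[OF lin])
  have "snd (\<Phi> X) = 0" if "snd X = 0" for X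
  proof -
    have "snd (M (\<Phi> X)) = 0" using that by (simp add: left)
    then have "M (0, snd (\<Phi> X)) = 0"
      using assms split[of "\<Phi> X"] by (simp add: block_diagonal_def prod_eq_iff)
    then have "\<Phi> (M (0, snd (\<Phi> X))) = \<Phi> 0" by (rule arg_cong)
    then have "(0::real^3, snd (\<Phi> X)) = 0" unfolding right PhiS(5) .
    then show ?thesis by (simp add: zero_prod_def)
  qed
  then show "\<Phi> ` g1 \<subseteq> g1" by (auto simp: g1_def)
  have "fst (\<Phi> X) = 0" if "fst X = 0" for X
  proof -
    have "fst (M (\<Phi> X)) = 0" using that by (simp add: left)
    then have "M (fst (\<Phi> X), 0) = 0"
      using assms split[of "\<Phi> X"] by (simp add: block_diagonal_def prod_eq_iff)
    then have "\<Phi> (M (fst (\<Phi> X), 0)) = \<Phi> 0" by (rule arg_cong)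
    then have "(fst (\<Phi> X), 0::real^3) = 0" unfolding right PhiS(5) .
    then show ?thesis by (simp add: zero_prod_def)
  qed
  then show "\<Phi> ` g2 \<subseteq> g2" by (auto simp: g2_def)
qed

lemma torus_case:
  assumes "torus_form M" "nonneg_sec_curv \<Phi>"
  obtains A1 A2 A3 B1 B2 B3 c d a1 a2 a3
  where "orthonormal_basis3 A1 A2 A3" "orthonormal_basis3 B1 B2 B3"
    "\<Phi> (A1, 0) = c *\<^sub>R (A1, 0)" "\<Phi> (A2, 0) = c *\<^sub>R (A2, 0)"
    "\<Phi> (0, B2) = d *\<^sub>R (0, B2)" "\<Phi> (0, B3) = d *\<^sub>R (0, B3)"
    "\<Phi> (A3, 0) = a1 *\<^sub>R (A3, 0) + a3 *\<^sub>R (0, B1)"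
    "\<Phi> (0, B1) = a3 *\<^sub>R (A3, 0) + a2 *\<^sub>R (0, B1)"
    "\<And>\<alpha> \<beta> :: real. a1 * \<alpha>^2 + 2 * a3 * \<alpha> * \<beta> + a2 * \<beta>^2 \<le> 4/3 * (c * \<alpha>^2 + d * \<beta>^2)"
proof -
  \<comment> \<open>These \<open>c\<close> and \<open>d\<close> are eigenvalues of \<open>M\<close>;
    the witnesses for \<Phi> are their reciprocals.\<close>
  obtain A1 A2 A3 B1 B2 B3 c d where fr: "oriented_frame A1 A2 A3" "oriented_frame B1 B2 B3"
    and M: "M (A1, 0) = c *\<^sub>R (A1, 0)" "M (A2, 0) = c *\<^sub>R (A2, 0)"
      "M (0, B2) = d *\<^sub>R (0, B2)" "M (0, B3) = d *\<^sub>R (0, B3)"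
    using assms(1) unfolding torus_form_def by blast
  note f = oriented_frameD[OF fr(1)] oriented_frameD[OF fr(2)]
  have "A1 \<noteq> 0" "A2 \<noteq> 0" "B2 \<noteq> 0" "B3 \<noteq> 0" using f by auto
  then have P: "\<Phi> (A1, 0) = (1/c) *\<^sub>R (A1, 0)" "\<Phi> (A2, 0) = (1/c) *\<^sub>R (A2, 0)"
      "\<Phi> (0, B2) = (1/d) *\<^sub>R (0, B2)" "\<Phi> (0, B3) = (1/d) *\<^sub>R (0, B3)"
    using M Phi_eigen by (auto simp: zero_prod_def simp del: scaleR_Pair)
  define a1 a2 a3 where "a1 = \<Phi> (A3, 0) \<bullet> (A3, 0)" and "a2 = \<Phi> (0, B1) \<bullet> (0, B1)"
    and "a3 = \<Phi> (A3, 0) \<bullet> (0, B1)"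
  \<comment> \<open>Self-adjointness removes the components along the four eigenvectors, leaving the
    plane of \<open>A3\<close> and \<open>B1\<close>.\<close>
  have P3: "\<Phi> (A3, 0) = a1 *\<^sub>R (A3, 0) + a3 *\<^sub>R (0, B1)"
    by (subst so4_expand[OF fr, of "\<Phi> (A3, 0)"])
       (simp add: selfadj[of _ "(A1, 0)"] selfadj[of _ "(A2, 0)"] selfadj[of _ "(0, B2)"]
         selfadj[of _ "(0, B3)"] P f a1_def a3_def)
  have P4: "\<Phi> (0, B1) = a3 *\<^sub>R (A3, 0) + a2 *\<^sub>R (0, B1)"
    by (subst so4_expand[OF fr, of "\<Phi> (0, B1)"])
       (simp add: selfadj[of _ "(A1, 0)"] selfadj[of _ "(A2, 0)"] selfadj[of _ "(0, B2)"]
         selfadj[of _ "(0, B3)"] selfadj[of "(0, B1)" "(A3, 0)"] inner_commute[of "(0, B1)"]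
         P f a2_def a3_def)
  \<comment> \<open>The constant 4/3 is the reciprocal of the 3/4 in Puettmann's formula.\<close>
  have scale_bound: "q \<le> 4/3 * p" if "0 \<le> p - 3/4 * q" for p q :: real
    using that by simp
  text \<open>For X and Y as below the bracket of X and Y is an arbitrary vector of the plane spanned by
    A3 and B1, and the last two terms of Puettmann's formula vanish.\<close>
  have "a1 * \<alpha>^2 + 2 * a3 * \<alpha> * \<beta> + a2 * \<beta>^2 \<le> 4/3 * ((1/c) * \<alpha>^2 + (1/d) * \<beta>^2)" for \<alpha> \<beta>
  proof -
    define X Y where "X = \<alpha> *\<^sub>R (A1, 0) + \<beta> *\<^sub>R (0, B2)" and "Y = (A2, 0::real^3) + (0::real^3, B3)"
    define Z W where "Z = \<alpha> *\<^sub>R (A3, 0) + \<beta> *\<^sub>R (0, B1)"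
      and "W = (\<alpha> / c) *\<^sub>R (A3, 0) + (\<beta> / d) *\<^sub>R (0, B1)"
    interpret so4_frame "(A1, 0)" "(A2, 0)" "(A3, 0)" "(0, B1)" "(0, B2)" "(0, B3)"
      by (rule so4_frame_oriented_frames[OF fr])
    have XY: "lie X Y = Z"
      by (simp add: X_def Y_def Z_def lie_simps lie_frame del: scaleR_Pair add_Pair)
    have PX: "\<Phi> X = (\<alpha> / c) *\<^sub>R (A1, 0) + (\<beta> / d) *\<^sub>R (0, B2)"
      unfolding X_def PhiS P by simp
    have PY: "\<Phi> Y = (1 / c) *\<^sub>R (A2, 0) + (1 / d) *\<^sub>R (0, B3)"
      unfolding Y_def PhiS P ..
    have PXY: "lie (\<Phi> X) Y = W"
      unfolding PX by (simp add: Y_def W_def lie_simps lie_frame del: scaleR_Pair add_Pair)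
    have XPY: "lie X (\<Phi> Y) = W"
      unfolding PY by (simp add: X_def W_def lie_simps lie_frame del: scaleR_Pair add_Pair)
    have XX: "lie X (\<Phi> X) = 0"
      unfolding PX by (simp add: X_def lie_simps lie_frame del: scaleR_Pair add_Pair)
    have "0 \<le> metric \<Phi> (curv \<Phi> X Y Y) X"
      using assms(2) by (simp only: nonneg_sec_curv_def)
    also have "\<dots> = W \<bullet> Z - 3/4 * (\<Phi> Z \<bullet> Z)"
      by (simp add: metric_curv XY PXY XPY XX MS inner_add_left)
    also have "W \<bullet> Z = (1/c) * \<alpha>^2 + (1/d) * \<beta>^2"
      by (simp add: W_def Z_def f power2_eq_square)
    also have "\<Phi> Z \<bullet> Z = a1 * \<alpha>^2 + 2 * a3 * \<alpha> * \<beta> + a2 * \<beta>^2"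
      unfolding Z_def PhiS P3 P4 by (simp add: f power2_eq_square algebra_simps)
    finally show ?thesis
      using scale_bound by blast
  qed
  then show ?thesis
    using that[OF oriented_frame_imp_orthonormal_basis3[OF fr(1)]
        oriented_frame_imp_orthonormal_basis3[OF fr(2)] P P3 P4] by blast
qed

end

section \<open>Existence of the inverse matrix and the final case distinction\<close>

lemma metric_matrix_inverse:
  assumes "metric_matrix \<Phi>"
  obtains M where "metric_inverse \<Phi> M"
proof -
  have lin: "linear \<Phi>" and pos: "\<And>X. X \<noteq> 0 \<Longrightarrow> \<Phi> X \<bullet> X > 0"
    using assms unfolding metric_matrix_def h0_def by blast+
  have "inj \<Phi>"
    unfolding linear_injective_0[OF lin] by (metis inner_zero_left less_irrefl pos)
  then obtain M where "linear M" "\<forall>x. M (\<Phi> x) = x" "\<forall>x. \<Phi> (M x) = x"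
    using linear_injective_isomorphism[OF lin] by blast
  then show ?thesis
    using assms by (intro that[of M] metric_inverse.intro) blast+
qed

theorem mainTheorem10:
  fixes \<Phi> :: "so4 \<Rightarrow> so4"
  assumes "metric_matrix \<Phi>"
    and "nonneg_sec_curv \<Phi>"
    and "\<exists>v lam. v \<noteq> 0 \<and> singular v \<and> \<Phi> v = lam *\<^sub>R v"
  shows "(\<Phi> ` g1 \<subseteq> g1 \<and> \<Phi> ` g2 \<subseteq> g2) \<or>
    (\<exists>A1 A2 A3 B1 B2 B3 :: real^3. \<exists>c d a1 a2 a3 :: real.
       orthonormal_basis3 A1 A2 A3 \<and> orthonormal_basis3 B1 B2 B3 \<and>
       \<Phi> (A1, 0) = c *\<^sub>R (A1, 0) \<and> \<Phi> (A2, 0) = c *\<^sub>R (A2, 0) \<and>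
       \<Phi> (0, B2) = d *\<^sub>R (0, B2) \<and> \<Phi> (0, B3) = d *\<^sub>R (0, B3) \<and>
       \<Phi> (A3, 0) = a1 *\<^sub>R (A3, 0) + a3 *\<^sub>R (0, B1) \<and>
       \<Phi> (0, B1) = a3 *\<^sub>R (A3, 0) + a2 *\<^sub>R (0, B1) \<and>
       (\<forall>\<alpha> \<beta> :: real. a1 * \<alpha>^2 + 2 * a3 * \<alpha> * \<beta> + a2 * \<beta>^2
            \<le> 4/3 * (c * \<alpha>^2 + d * \<beta>^2)))"
proof -
  obtain M where "metric_inverse \<Phi> M" using metric_matrix_inverse[OF assms(1)] .
  then interpret metric_inverse \<Phi> M .
  obtain v lam where v: "v \<noteq> 0" "singular v" "\<Phi> v = lam *\<^sub>R v" using assms(3) by blast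
  \<comment> \<open>The singular eigenvector passes to \<open>M\<close>; \<open>lam\<close> is
    nonzero because \<open>v\<close> is.\<close>
  have "v = lam *\<^sub>R M v" using left[of v] by (simp add: v(3) MS)
  then have "M v = (1 / lam) *\<^sub>R v"
    using v(1) by (metis divideR_right inverse_eq_divide scaleR_zero_left)
  then have "block_diagonal M \<or> torus_form M"
    using cubic_curv_rigidity[OF lin M_selfadj cubic_curv_nonneg[OF assms(2)] v(1,2)] by blast
  then show ?thesis
  proof
    assume "block_diagonal M"
    then show ?thesis using product_case by blast
  next
    assume "torus_form M"
    then show ?thesis using torus_case[OF _ assms(2)] by (metis (no_types, lifting))
  qed
qed

end
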